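(* Let $L$ be a $\kappa$-frame and let $C$ be a congruence on $L$. The quotient $\kappa$-frame $L/C$ is clear if and only if the congruence $C$ is clear.
   Context: Here $\kappa$ is either an infinite regular cardinal or the symbol $\infty$. A $\kappa$-set is a set of cardinality less than $\kappa$ (any set if $\kappa=\infty$). A $\kappa$-frame is a bounded distributive lattice with joins of all $\kappa$-sets, over which binary meets distribute; for $\kappa=\infty$ this is a frame. A congruence on $L$ is an equivalence relation on $L$ closed under finite meets and $\kappa$-joins in $L\times L$; congruences are ordered by inclusion. A $\kappa$-ideal on $L$ is a downset closed under $\kappa$-joins (for $\kappa=\infty$, a principal ideal). Clear congruences: for a $\kappa$-ideal $I$, let $\widetilde\nabla_I=\bigvee_{a\in I}\nabla_a$ where $\nabla_a$ is the congruence generated by $(0,a)$. The closure $\mathrm{cl}(C)$ of a congruence $C$ is the largest congruence of the form $\widetilde\nabla_I$ contained in $C$. For $D\le C$, $C$ is dense in $D$ if $\mathrm{cl}(C)\le D$. For each $\kappa$-ideal $I$ there is a largest congruence $\partial_I$ dense in $\widetilde\nabla_I$; explicitly $\partial_I=\{(a,b)\mid \forall x\in L:\ a\wedge x\in I\iff b\wedge x\in I\}$. A congruence of the form $\partial_I$ is called clear. Clear $\kappa$-frames: a $\kappa$-frame $M$ has a largest dense congruence $\mathfrak{D}_M=\{(a,b)\mid \forall x\in M:\ a\wedge x=0\iff b\wedge x=0\}$, and $M$ is called clear if $\mathfrak{D}_M$ is the equality relation. *)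

theory Defs
  imports "HOL-Algebra.Lattice"
begin

unbundle cardinal_syntax

(* The parameter kappa has type 'k rel option: Some r stands for the cardinal r
   (a cardinal order on a subset of 'k), and None stands for the symbol infinity. *)

definition regular_or_infty :: "'k rel option \<Rightarrow> bool" where
  "regular_or_infty \<kappa> \<longleftrightarrow>
     (case \<kappa> of None \<Rightarrow> True | Some r \<Rightarrow> Cinfinite r \<and> regularCard r)"

definition kset :: "'k rel option \<Rightarrow> 'b set \<Rightarrow> bool" where
  "kset \<kappa> S \<longleftrightarrow> (case \<kappa> of None \<Rightarrow> True | Some r \<Rightarrow> |S| <o r)"

(* Since kappa is infinite, two-element sets are kappa-sets, so the last assumption
   contains the distributivity of the lattice. *)

locale kframe = bounded_lattice L for \<kappa> :: "'k rel option" and L (structure) +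
  assumes kjoin_exists:
      "\<lbrakk>S \<subseteq> carrier L; kset \<kappa> S\<rbrakk> \<Longrightarrow> \<exists>s. least L s (Upper L S)"
    and meet_kjoin_distrib:
      "\<lbrakk>a \<in> carrier L; S \<subseteq> carrier L; kset \<kappa> S\<rbrakk>
         \<Longrightarrow> a \<sqinter> (\<Squnion>S) = \<Squnion>((\<lambda>s. a \<sqinter> s) ` S)"

(* Joins and meets in the product of L with itself are componentwise; the empty meet
   of pairs lies in C by reflexivity. *)

definition kcongruence ::
    "'k rel option \<Rightarrow> ('a, 'm) gorder_scheme \<Rightarrow> 'a rel \<Rightarrow> bool" where
  "kcongruence \<kappa> L C \<longleftrightarrow>
     equiv (carrier L) C \<and>
     (\<forall>a b c d. (a, b) \<in> C \<longrightarrow> (c, d) \<in> C \<longrightarrow> (a \<sqinter>\<^bsub>L\<^esub> c, b \<sqinter>\<^bsub>L\<^esub> d) \<in> C) \<and>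
     (\<forall>R. R \<subseteq> C \<longrightarrow> kset \<kappa> R \<longrightarrow> (\<Squnion>\<^bsub>L\<^esub>(fst ` R), \<Squnion>\<^bsub>L\<^esub>(snd ` R)) \<in> C)"

definition Con :: "'k rel option \<Rightarrow> ('a, 'm) gorder_scheme \<Rightarrow> ('a rel) gorder" where
  "Con \<kappa> L = \<lparr>carrier = {C. kcongruence \<kappa> L C}, eq = (=), le = (\<subseteq>)\<rparr>"

definition kideal ::
    "'k rel option \<Rightarrow> ('a, 'm) gorder_scheme \<Rightarrow> 'a set \<Rightarrow> bool" where
  "kideal \<kappa> L I \<longleftrightarrow>
     I \<subseteq> carrier L \<and>
     (\<forall>a\<in>I. \<forall>b\<in>carrier L. b \<sqsubseteq>\<^bsub>L\<^esub> a \<longrightarrow> b \<in> I) \<and>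
     (\<forall>S. S \<subseteq> I \<longrightarrow> kset \<kappa> S \<longrightarrow> \<Squnion>\<^bsub>L\<^esub>S \<in> I)"

definition nabla :: "'k rel option \<Rightarrow> ('a, 'm) gorder_scheme \<Rightarrow> 'a \<Rightarrow> 'a rel" where
  "nabla \<kappa> L a = \<Inter>{C. kcongruence \<kappa> L C \<and> (\<bottom>\<^bsub>L\<^esub>, a) \<in> C}"

definition nabla_ideal ::
    "'k rel option \<Rightarrow> ('a, 'm) gorder_scheme \<Rightarrow> 'a set \<Rightarrow> 'a rel" where
  "nabla_ideal \<kappa> L I = \<Squnion>\<^bsub>Con \<kappa> L\<^esub>(nabla \<kappa> L ` I)"

definition con_closure ::
    "'k rel option \<Rightarrow> ('a, 'm) gorder_scheme \<Rightarrow> 'a rel \<Rightarrow> 'a rel" where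
  "con_closure \<kappa> L C =
     (THE D. greatest (Con \<kappa> L) D
        {nabla_ideal \<kappa> L I | I. kideal \<kappa> L I \<and> nabla_ideal \<kappa> L I \<subseteq> C})"

definition dense_in ::
    "'k rel option \<Rightarrow> ('a, 'm) gorder_scheme \<Rightarrow> 'a rel \<Rightarrow> 'a rel \<Rightarrow> bool" where
  "dense_in \<kappa> L C D \<longleftrightarrow> D \<subseteq> C \<and> con_closure \<kappa> L C \<subseteq> D"

definition clear_con_of ::
    "'k rel option \<Rightarrow> ('a, 'm) gorder_scheme \<Rightarrow> 'a set \<Rightarrow> 'a rel" where
  "clear_con_of \<kappa> L I =
     (THE C. greatest (Con \<kappa> L) C
        {E. kcongruence \<kappa> L E \<and> dense_in \<kappa> L E (nabla_ideal \<kappa> L I)})"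

definition clear_congruence ::
    "'k rel option \<Rightarrow> ('a, 'm) gorder_scheme \<Rightarrow> 'a rel \<Rightarrow> bool" where
  "clear_congruence \<kappa> L C \<longleftrightarrow> (\<exists>I. kideal \<kappa> L I \<and> C = clear_con_of \<kappa> L I)"

(* A congruence is called dense when it is dense in the equality congruence. *)

definition largest_dense_con ::
    "'k rel option \<Rightarrow> ('a, 'm) gorder_scheme \<Rightarrow> 'a rel" where
  "largest_dense_con \<kappa> M =
     (THE D. greatest (Con \<kappa> M) D
        {E. kcongruence \<kappa> M E \<and> dense_in \<kappa> M E (Id_on (carrier M))})"

definition clear_kframe :: "'k rel option \<Rightarrow> ('a, 'm) gorder_scheme \<Rightarrow> bool" where
  "clear_kframe \<kappa> M \<longleftrightarrow>
     kframe \<kappa> M \<and> largest_dense_con \<kappa> M = Id_on (carrier M)"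

(* The order is that of the induced meet operation [a] \<sqinter> [b] = [a \<sqinter> b]:
   X is below Y iff their meet is X. *)

definition quotient_frame ::
    "('a, 'm) gorder_scheme \<Rightarrow> 'a rel \<Rightarrow> ('a set) gorder" where
  "quotient_frame L C =
     \<lparr>carrier = carrier L // C, eq = (=),
      le = (\<lambda>X Y. \<exists>a\<in>X. \<exists>b\<in>Y. a \<sqinter>\<^bsub>L\<^esub> b \<in> X)\<rparr>"

end

theory Submission
  imports Defs
begin

text \<open>
  Call the class of \<open>\<bottom>\<close> under a congruence its kernel. The proof reduces clearness, of a
  congruence and of a frame alike, to one condition on kernels.

  For a \<open>\<kappa>\<close>-ideal \<open>I\<close>, two elements \<open>a\<close>, \<open>b\<close> are related by the syntactic congruence of \<open>I\<close> if no
  test \<open>_ \<sqinter> x \<in> I\<close> tells them apart. A congruence with kernel \<open>I\<close> is closed under meeting with \<open>x\<close>,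
  so it cannot relate elements that such a test separates; and the syntactic congruence itself has
  kernel \<open>I\<close>, as the test \<open>x = \<top>\<close> shows. Hence it is the largest congruence with kernel \<open>I\<close>
  (\<open>kcongruence_syntactic_con\<close>, \<open>ker_syntactic_con\<close>, \<open>subset_syntactic_con_ker\<close>).

  The congruence generated by an ideal \<open>I\<close> is the smallest one whose kernel includes \<open>I\<close>, and its
  kernel is exactly \<open>I\<close>. So the closure of \<open>E\<close> is the congruence generated by the kernel of \<open>E\<close>, and
  \<open>E\<close> is dense in the congruence generated by \<open>I\<close> precisely when \<open>E\<close> has kernel \<open>I\<close>
  (\<open>dense_in_nabla_ideal_iff\<close>). Therefore the largest congruence dense in it is the syntactic
  congruence of \<open>I\<close>, and \<open>C\<close> is clear iff it includes the syntactic congruence of its own kernel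
  (\<open>clear_congruence_iff\<close>). The case \<open>I = {\<bottom>}\<close> shows that a frame is clear iff the syntactic
  congruence of \<open>{\<bottom>}\<close> is the equality (\<open>clear_kframe_iff\<close>).

  Finally, the quotient of \<open>L\<close> by \<open>C\<close> is a \<open>\<kappa>\<close>-frame whose meets and \<open>\<kappa>\<close>-joins are computed on
  representatives, and the class of \<open>a\<close> is the bottom element iff \<open>a\<close> is in the kernel of \<open>C\<close>. So the
  syntactic congruence of \<open>{\<bottom>}\<close> on the quotient pulls back to the syntactic congruence of the kernel
  of \<open>C\<close>, and the equality pulls back to \<open>C\<close>: the two conditions of clearness are the same.
\<close>

section \<open>Small sets, joins and meets\<close>

lemma kset_image:
  assumes "kset \<kappa> S"
  shows "kset \<kappa> (f ` S)"
  using assms card_of_image[of f S]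
  by (auto simp: kset_def split: option.splits intro: ordLeq_ordLess_trans)

lemma kset_finite:
  assumes "regular_or_infty \<kappa>" "finite S"
  shows "kset \<kappa> S"
proof (cases \<kappa>)
  case (Some r)
  then have "Cinfinite r"
    using assms(1) by (simp add: regular_or_infty_def)
  moreover have "Cfinite |S|"
    using assms(2) by (simp add: cfinite_def Field_card_of card_of_card_order_on)
  ultimately show ?thesis
    using Some by (simp add: kset_def Cfinite_ordLess_Cinfinite)
qed (simp add: kset_def)

lemma sup_is_least:
  assumes "\<exists>s. least L s (Upper L S)"
  shows "least L (\<Squnion>\<^bsub>L\<^esub>S) (Upper L S)"
  unfolding sup_def using assms by (rule someI_ex)

locale infinitary_kframe = kframe \<kappa> L for \<kappa> :: "'k rel option" and L (structure) +
  assumes regular: "regular_or_infty \<kappa>"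
begin

lemma meet_assoc:
  assumes "x \<in> carrier L" "y \<in> carrier L" "z \<in> carrier L"
  shows "(x \<sqinter> y) \<sqinter> z = x \<sqinter> (y \<sqinter> z)"
  using weak_meet_assoc[OF assms] by (simp add: eq_is_equal)

lemma meet_left_commute:
  assumes "x \<in> carrier L" "y \<in> carrier L" "z \<in> carrier L"
  shows "x \<sqinter> (y \<sqinter> z) = y \<sqinter> (x \<sqinter> z)"
  by (simp only: meet_assoc[OF assms, symmetric] meet_assoc[OF assms(2,1,3), symmetric]
      meet_comm[of L x y])

lemma meet_absorb:
  assumes "a \<in> carrier L" "b \<in> carrier L" "b \<sqsubseteq> a"
  shows "a \<sqinter> b = b"
  unfolding meet_comm[of L a b] using le_iff_join[OF assms(2,1)] assms(3) by metis

lemma meet_top: "x \<in> carrier L \<Longrightarrow> x \<sqinter> \<top> = x"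
  by (metis le_iff_join top_closed top_higher)

lemma meet_bottom: "x \<in> carrier L \<Longrightarrow> \<bottom> \<sqinter> x = \<bottom>"
  by (metis le_iff_join bottom_closed bottom_lower)

lemma kjoin_least:
  assumes "S \<subseteq> carrier L" "kset \<kappa> S"
  shows "least L (\<Squnion>S) (Upper L S)"
  using sup_is_least kjoin_exists[OF assms] .

lemma kjoin_closed:
  assumes "S \<subseteq> carrier L" "kset \<kappa> S"
  shows "\<Squnion>S \<in> carrier L"
  using kjoin_least[OF assms] by (rule least_closed)

lemma kjoin_upper:
  assumes "S \<subseteq> carrier L" "kset \<kappa> S" "s \<in> S"
  shows "s \<sqsubseteq> \<Squnion>S"
  using kjoin_least[OF assms(1,2)] assms(3,1) by (rule least_Upper_above)

lemma least_imp_kjoin_eq: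
  assumes "least L s (Upper L S)"
  shows "\<Squnion>S = s"
  using least_unique[OF sup_is_least[OF exI[of _ s]]] assms by simp

lemma kjoin_empty: "\<Squnion>{} = \<bottom>"
  using bottom_least by (intro least_imp_kjoin_eq) simp

lemma kjoin_bottom: "\<Squnion>{\<bottom>} = \<bottom>"
  by (intro least_imp_kjoin_eq least_UpperI) (auto simp: Upper_def)

section \<open>Congruences and their kernels\<close>

lemma kcongruence_carrier:
  assumes "kcongruence \<kappa> L C" "(a, b) \<in> C"
  shows "a \<in> carrier L" "b \<in> carrier L"
  using assms by (auto simp: kcongruence_def equiv_def)

lemma kcongruence_refl:
  assumes "kcongruence \<kappa> L C" "a \<in> carrier L"
  shows "(a, a) \<in> C"
  using assms by (auto simp: kcongruence_def equiv_def refl_on_def)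

lemma kcongruence_sym:
  assumes "kcongruence \<kappa> L C" "(a, b) \<in> C"
  shows "(b, a) \<in> C"
  using assms by (auto simp: kcongruence_def equiv_def dest: symD)

lemma kcongruence_trans:
  assumes "kcongruence \<kappa> L C" "(a, b) \<in> C" "(b, c) \<in> C"
  shows "(a, c) \<in> C"
  using assms by (auto simp: kcongruence_def equiv_def dest: transD)

lemma kcongruence_meet:
  assumes "kcongruence \<kappa> L C" "(a, b) \<in> C" "(c, d) \<in> C"
  shows "(a \<sqinter> c, b \<sqinter> d) \<in> C"
  using assms by (auto simp: kcongruence_def)

text \<open>The indexed form avoids having to present the family as a set of pairs at each use.\<close>

lemma kcongruence_kjoin:
  assumes "kcongruence \<kappa> L C" "kset \<kappa> S" "\<And>s. s \<in> S \<Longrightarrow> (f s, g s) \<in> C"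
  shows "(\<Squnion>(f ` S), \<Squnion>(g ` S)) \<in> C"
proof -
  let ?R = "(\<lambda>s. (f s, g s)) ` S"
  have "?R \<subseteq> C" "kset \<kappa> ?R"
    using assms(2,3) by (auto intro: kset_image)
  then have "(\<Squnion>(fst ` ?R), \<Squnion>(snd ` ?R)) \<in> C"
    using assms(1) by (simp add: kcongruence_def)
  then show ?thesis
    by (simp add: image_image)
qed

lemma kcongruence_Inter:
  assumes "\<C> \<noteq> {}" and con: "\<And>C. C \<in> \<C> \<Longrightarrow> kcongruence \<kappa> L C"
  shows "kcongruence \<kappa> L (\<Inter>\<C>)"
  unfolding kcongruence_def
proof (intro conjI allI impI)
  show "equiv (carrier L) (\<Inter>\<C>)"
  proof (rule equivI)
    obtain C where "C \<in> \<C>" "C \<subseteq> carrier L \<times> carrier L"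
      using assms(1) kcongruence_carrier[OF con] by fast
    then show "\<Inter>\<C> \<subseteq> carrier L \<times> carrier L"
      by blast
    show "refl_on (carrier L) (\<Inter>\<C>)"
      using kcongruence_refl[OF con] by (simp add: refl_on_def)
    show "sym (\<Inter>\<C>)"
      using con by (simp add: kcongruence_def equiv_def sym_def)
    show "trans (\<Inter>\<C>)"
    proof (intro transI InterI)
      fix a b c C assume "(a, b) \<in> \<Inter>\<C>" "(b, c) \<in> \<Inter>\<C>" "C \<in> \<C>"
      then show "(a, c) \<in> C"
        using kcongruence_trans[OF con, of C a b c] by blast
    qed
  qed
next
  fix a b c d assume "(a, b) \<in> \<Inter>\<C>" "(c, d) \<in> \<Inter>\<C>"
  then show "(a \<sqinter> c, b \<sqinter> d) \<in> \<Inter>\<C>"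
    using kcongruence_meet[OF con] by simp
next
  fix R assume R: "R \<subseteq> \<Inter>\<C>" "kset \<kappa> R"
  show "(\<Squnion>(fst ` R), \<Squnion>(snd ` R)) \<in> \<Inter>\<C>"
  proof
    fix C assume "C \<in> \<C>"
    then show "(\<Squnion>(fst ` R), \<Squnion>(snd ` R)) \<in> C"
      using R by (intro kcongruence_kjoin[OF con]) auto
  qed
qed

lemma kcongruence_Id_on: "kcongruence \<kappa> L (Id_on (carrier L))"
  unfolding kcongruence_def
proof (intro conjI allI impI)
  show "equiv (carrier L) (Id_on (carrier L))"
    by (intro equivI) (auto simp: refl_on_def sym_def trans_def)
next
  fix R assume R: "R \<subseteq> Id_on (carrier L)" "kset \<kappa> R"
  then have "snd ` R = fst ` R"
    by (intro image_cong) auto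
  moreover have "fst ` R \<subseteq> carrier L" "kset \<kappa> (fst ` R)"
    using R by (auto intro: kset_image)
  ultimately show "(\<Squnion>(fst ` R), \<Squnion>(snd ` R)) \<in> Id_on (carrier L)"
    using kjoin_closed by auto
qed auto

definition ker :: "'a rel \<Rightarrow> 'a set" where
  "ker C = {a. (\<bottom>, a) \<in> C}"

lemma ker_iff: "a \<in> ker C \<longleftrightarrow> (\<bottom>, a) \<in> C"
  by (simp add: ker_def)

lemma kideal_ker:
  assumes C: "kcongruence \<kappa> L C"
  shows "kideal \<kappa> L (ker C)"
  unfolding kideal_def
proof (intro conjI ballI allI impI)
  show "ker C \<subseteq> carrier L"
    using kcongruence_carrier(2)[OF C] unfolding ker_def by blast
next
  fix a b assume a: "a \<in> ker C" and b: "b \<in> carrier L" and "b \<sqsubseteq> a"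
  then have "a \<sqinter> b = b"
    using kcongruence_carrier(2)[OF C] b by (intro meet_absorb) (auto simp only: ker_iff)
  moreover have "(\<bottom> \<sqinter> b, a \<sqinter> b) \<in> C"
    using a kcongruence_refl[OF C b] by (intro kcongruence_meet[OF C]) (simp_all only: ker_iff)
  ultimately show "b \<in> ker C"
    using b by (simp add: ker_def meet_bottom)
next
  fix S assume S: "S \<subseteq> ker C" "kset \<kappa> S"
  \<comment> \<open>Every element of \<open>S\<close> is congruent to \<open>\<bottom>\<close>, so its join is congruent to a join of copies of \<open>\<bottom>\<close>.\<close>
  have "(\<Squnion>((\<lambda>_. \<bottom>) ` S), \<Squnion>((\<lambda>s. s) ` S)) \<in> C"
    using S(1) by (intro kcongruence_kjoin[OF C S(2)]) (auto simp only: ker_iff)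
  moreover have "\<Squnion>((\<lambda>_. \<bottom>) ` S) = \<bottom>"
    unfolding image_constant_conv by (simp only: kjoin_empty kjoin_bottom if_cancel split: if_split) simp
  ultimately show "\<Squnion>S \<in> ker C"
    by (simp only: ker_iff image_ident)
qed

lemma kideal_subset: "kideal \<kappa> L I \<Longrightarrow> I \<subseteq> carrier L"
  by (simp add: kideal_def)

lemma kideal_down:
  assumes "kideal \<kappa> L I" "a \<in> I" "b \<in> carrier L" "b \<sqsubseteq> a"
  shows "b \<in> I"
  using assms by (auto simp: kideal_def)

lemma kideal_kjoin_iff:
  assumes I: "kideal \<kappa> L I" and S: "S \<subseteq> carrier L" "kset \<kappa> S"
  shows "\<Squnion>S \<in> I \<longleftrightarrow> S \<subseteq> I"
proof
  assume "\<Squnion>S \<in> I"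
  then show "S \<subseteq> I"
    using kideal_down[OF I] kjoin_upper[OF S] S(1) by blast
next
  assume "S \<subseteq> I"
  then show "\<Squnion>S \<in> I"
    using I S(2) by (simp add: kideal_def)
qed

text \<open>An ideal is nonempty because it contains the join of the empty set.\<close>

lemma bottom_in_kideal:
  assumes "kideal \<kappa> L I"
  shows "\<bottom> \<in> I"
  using kideal_kjoin_iff[OF assms, of "{}"] kset_finite[OF regular finite.emptyI]
  by (simp add: kjoin_empty)

lemma kideal_bottom: "kideal \<kappa> L {\<bottom>}"
  unfolding kideal_def
proof (intro conjI ballI allI impI)
  fix S assume "S \<subseteq> {\<bottom>}"
  then consider "S = {}" | "S = {\<bottom>}" by blast
  then show "\<Squnion>S \<in> {\<bottom>}"
    by cases (simp_all add: kjoin_empty kjoin_bottom)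
next
  fix a b assume "a \<in> {\<bottom>}" "b \<in> carrier L" "b \<sqsubseteq> a"
  then show "b \<in> {\<bottom>}"
    using le_antisym[of b \<bottom>] by simp
qed simp

section \<open>The syntactic congruence of an ideal\<close>

text \<open>
  This is the analogue of the syntactic congruence of a language: elements are identified when they
  behave alike in all contexts \<open>_ \<sqinter> x\<close> with respect to membership in \<open>I\<close>. It is the explicit form of
  the congruence usually written with the symbol \<open>\<partial>\<close>, indexed by \<open>I\<close>.
\<close>

definition syntactic_con :: "'a set \<Rightarrow> 'a rel" where
  "syntactic_con I =
     {(a, b). a \<in> carrier L \<and> b \<in> carrier L \<and> (\<forall>x\<in>carrier L. a \<sqinter> x \<in> I \<longleftrightarrow> b \<sqinter> x \<in> I)}"

text \<open>
  For meets, the two related pairs are exchanged one at a time, the other factor being absorbed into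
  the test element. For joins, distributivity turns a test of the join into the conjunction of the
  tests of its members, because an ideal contains a \<open>\<kappa>\<close>-join iff it contains all the members.
\<close>

lemma kcongruence_syntactic_con:
  assumes I: "kideal \<kappa> L I"
  shows "kcongruence \<kappa> L (syntactic_con I)"
  unfolding kcongruence_def
proof (intro conjI allI impI)
  show "equiv (carrier L) (syntactic_con I)"
    by (intro equivI) (auto simp: syntactic_con_def refl_on_def sym_def trans_def)
next
  fix a b c d assume ab: "(a, b) \<in> syntactic_con I" and cd: "(c, d) \<in> syntactic_con I"
  then have carr: "a \<in> carrier L" "b \<in> carrier L" "c \<in> carrier L" "d \<in> carrier L"
    by (auto simp: syntactic_con_def)
  have "(a \<sqinter> c) \<sqinter> x \<in> I \<longleftrightarrow> (b \<sqinter> d) \<sqinter> x \<in> I" if x: "x \<in> carrier L" for x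
  proof -
    have "(a \<sqinter> c) \<sqinter> x \<in> I \<longleftrightarrow> a \<sqinter> (c \<sqinter> x) \<in> I"
      using carr x by (simp add: meet_assoc)
    also have "\<dots> \<longleftrightarrow> b \<sqinter> (c \<sqinter> x) \<in> I"
      using ab carr x by (auto simp: syntactic_con_def)
    also have "b \<sqinter> (c \<sqinter> x) = c \<sqinter> (b \<sqinter> x)"
      using carr x by (simp only: meet_left_commute)
    also have "\<dots> \<in> I \<longleftrightarrow> d \<sqinter> (b \<sqinter> x) \<in> I"
      using cd carr x by (auto simp: syntactic_con_def)
    also have "d \<sqinter> (b \<sqinter> x) = (b \<sqinter> d) \<sqinter> x"
      using carr x by (simp only: meet_left_commute[of d b] meet_assoc[of b d])
    finally show ?thesis .
  qed
  then show "(a \<sqinter> c, b \<sqinter> d) \<in> syntactic_con I"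
    using carr by (simp add: syntactic_con_def)
next
  fix R assume R: "R \<subseteq> syntactic_con I" "kset \<kappa> R"
  have kjoin_meet_iff: "\<Squnion>(f ` R) \<sqinter> x \<in> I \<longleftrightarrow> (\<forall>p\<in>R. f p \<sqinter> x \<in> I)"
    if f: "f ` R \<subseteq> carrier L" and x: "x \<in> carrier L" for f x
  proof -
    let ?S = "(\<lambda>p. f p \<sqinter> x) ` R"
    have "\<Squnion>(f ` R) \<sqinter> x = \<Squnion>?S"
      using meet_kjoin_distrib[OF x f kset_image[OF R(2)]]
      by (simp add: image_image meet_comm[of L x])
    moreover have "?S \<subseteq> carrier L" "kset \<kappa> ?S"
      using f x kset_image[OF R(2)] by auto
    ultimately show ?thesis
      using kideal_kjoin_iff[OF I] by auto
  qed
  have carr: "fst ` R \<subseteq> carrier L" "snd ` R \<subseteq> carrier L"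
    using R(1) by (auto simp: syntactic_con_def)
  moreover have "fst p \<sqinter> x \<in> I \<longleftrightarrow> snd p \<sqinter> x \<in> I" if "p \<in> R" "x \<in> carrier L" for p x
    using R(1) that by (auto simp: syntactic_con_def)
  ultimately show "(\<Squnion>(fst ` R), \<Squnion>(snd ` R)) \<in> syntactic_con I"
    using kjoin_closed[OF _ kset_image[OF R(2)]] by (auto simp: syntactic_con_def kjoin_meet_iff)
qed

lemma ker_syntactic_con:
  assumes I: "kideal \<kappa> L I"
  shows "ker (syntactic_con I) = I"
proof (intro equalityI subsetI)
  fix a assume "a \<in> ker (syntactic_con I)"
  \<comment> \<open>Test with \<open>\<top>\<close>, which leaves both elements unchanged.\<close>
  then have "\<bottom> \<sqinter> \<top> \<in> I \<longleftrightarrow> a \<sqinter> \<top> \<in> I" "a \<in> carrier L"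
    by (auto simp: ker_def syntactic_con_def)
  then show "a \<in> I"
    using bottom_in_kideal[OF I] by (simp add: meet_top)
next
  fix a assume a: "a \<in> I"
  then have "a \<in> carrier L"
    using kideal_subset[OF I] by blast
  moreover from this have "a \<sqinter> x \<in> I" if "x \<in> carrier L" for x
    using kideal_down[OF I a] that by (simp add: meet_left)
  ultimately show "a \<in> ker (syntactic_con I)"
    using bottom_in_kideal[OF I] by (simp add: ker_def syntactic_con_def meet_bottom)
qed

lemma subset_syntactic_con_ker:
  assumes E: "kcongruence \<kappa> L E"
  shows "E \<subseteq> syntactic_con (ker E)"
proof clarify
  fix a b assume ab: "(a, b) \<in> E"
  have "(a \<sqinter> x, b \<sqinter> x) \<in> E" if "x \<in> carrier L" for x
    using kcongruence_meet[OF E ab kcongruence_refl[OF E that]] .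
  then have "a \<sqinter> x \<in> ker E \<longleftrightarrow> b \<sqinter> x \<in> ker E" if "x \<in> carrier L" for x
    unfolding ker_iff using that
    by (blast dest: kcongruence_trans[OF E, of \<bottom>] intro: kcongruence_sym[OF E])
  then show "(a, b) \<in> syntactic_con (ker E)"
    using kcongruence_carrier[OF E ab] by (simp add: syntactic_con_def)
qed

section \<open>Closure, density and clear congruences\<close>

text \<open>
  The join of the congruences generated by the elements of \<open>I\<close> is the congruence generated by all
  of them together. The syntactic congruence of \<open>I\<close> serves as one congruence above all of these, so that
  the intersections involved are taken over nonempty families.
\<close>

lemma least_nabla_ideal:
  assumes I: "kideal \<kappa> L I"
  shows "least (Con \<kappa> L) (nabla_ideal \<kappa> L I) {D. kcongruence \<kappa> L D \<and> I \<subseteq> ker D}"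
proof -
  let ?N = "\<Inter>{D. kcongruence \<kappa> L D \<and> I \<subseteq> ker D}"
  have syn: "kcongruence \<kappa> L (syntactic_con I)" "I \<subseteq> ker (syntactic_con I)"
    using I by (simp_all add: kcongruence_syntactic_con ker_syntactic_con)
  have N: "kcongruence \<kappa> L ?N" "I \<subseteq> ker ?N"
    using syn by (intro kcongruence_Inter; blast) (auto simp: ker_def)
  have nabla: "kcongruence \<kappa> L (nabla \<kappa> L a)" if "a \<in> I" for a
  proof -
    have "(\<bottom>, a) \<in> syntactic_con I"
      using syn(2) that by (auto simp: ker_def)
    then show ?thesis
      unfolding nabla_def using syn(1) by (intro kcongruence_Inter) blast+
  qed
  have nabla_le: "nabla \<kappa> L a \<subseteq> D \<longleftrightarrow> a \<in> ker D" if "kcongruence \<kappa> L D" for a D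
    using that by (auto simp: nabla_def ker_def)
  have Upper: "Upper (Con \<kappa> L) (nabla \<kappa> L ` I) = {D. kcongruence \<kappa> L D \<and> I \<subseteq> ker D}"
  proof (intro equalityI subsetI)
    fix D assume "D \<in> Upper (Con \<kappa> L) (nabla \<kappa> L ` I)"
    then have "kcongruence \<kappa> L D" "\<forall>a\<in>I. nabla \<kappa> L a \<subseteq> D"
      using nabla by (simp_all add: Upper_def Con_def)
    then show "D \<in> {D. kcongruence \<kappa> L D \<and> I \<subseteq> ker D}"
      using nabla_le by blast
  next
    fix D assume "D \<in> {D. kcongruence \<kappa> L D \<and> I \<subseteq> ker D}"
    then have "kcongruence \<kappa> L D" "\<forall>a\<in>I. nabla \<kappa> L a \<subseteq> D"
      using nabla_le by blast+
    then show "D \<in> Upper (Con \<kappa> L) (nabla \<kappa> L ` I)"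
      by (auto simp: Upper_def Con_def)
  qed
  have "least (Con \<kappa> L) ?N (Upper (Con \<kappa> L) (nabla \<kappa> L ` I))"
    using N unfolding Upper by (auto simp: least_def Con_def)
  then show ?thesis
    unfolding nabla_ideal_def Upper[symmetric] by (intro sup_is_least exI)
qed

lemma kcongruence_nabla_ideal:
  assumes I: "kideal \<kappa> L I"
  shows "kcongruence \<kappa> L (nabla_ideal \<kappa> L I)"
  using least_mem[OF least_nabla_ideal[OF I]] by simp

lemma ker_mono: "C \<subseteq> D \<Longrightarrow> ker C \<subseteq> ker D"
  by (auto simp: ker_def)

lemma nabla_ideal_subset_iff:
  assumes I: "kideal \<kappa> L I" and D: "kcongruence \<kappa> L D"
  shows "nabla_ideal \<kappa> L I \<subseteq> D \<longleftrightarrow> I \<subseteq> ker D"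
proof
  assume "nabla_ideal \<kappa> L I \<subseteq> D"
  from ker_mono[OF this] show "I \<subseteq> ker D"
    using least_mem[OF least_nabla_ideal[OF I]] by blast
next
  assume "I \<subseteq> ker D"
  then show "nabla_ideal \<kappa> L I \<subseteq> D"
    using least_le[OF least_nabla_ideal[OF I], of D] D by (simp add: Con_def)
qed

lemma ker_nabla_ideal:
  assumes I: "kideal \<kappa> L I"
  shows "ker (nabla_ideal \<kappa> L I) = I"
proof
  show "I \<subseteq> ker (nabla_ideal \<kappa> L I)"
    using nabla_ideal_subset_iff[OF I kcongruence_nabla_ideal[OF I]] by simp
  have "nabla_ideal \<kappa> L I \<subseteq> syntactic_con I"
    using nabla_ideal_subset_iff[OF I kcongruence_syntactic_con[OF I]]
    by (simp add: ker_syntactic_con[OF I])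
  then show "ker (nabla_ideal \<kappa> L I) \<subseteq> I"
    using ker_mono[of _ "syntactic_con I"] by (simp add: ker_syntactic_con[OF I])
qed

text \<open>Antisymmetry of inclusion turns the definite descriptions into plain greatest elements.\<close>

lemma The_greatest_Con:
  assumes "greatest (Con \<kappa> L) G X"
  shows "(THE D. greatest (Con \<kappa> L) D X) = G"
  using assms by (intro the_equality) (auto simp: greatest_def Con_def)

lemma con_closure_eq:
  assumes E: "kcongruence \<kappa> L E"
  shows "con_closure \<kappa> L E = nabla_ideal \<kappa> L (ker E)"
  unfolding con_closure_def
proof (rule The_greatest_Con)
  let ?X = "{nabla_ideal \<kappa> L I | I. kideal \<kappa> L I \<and> nabla_ideal \<kappa> L I \<subseteq> E}"
  have "nabla_ideal \<kappa> L (ker E) \<in> ?X"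
    using kideal_ker[OF E] nabla_ideal_subset_iff[OF kideal_ker[OF E] E] by blast
  moreover have "kcongruence \<kappa> L D \<and> D \<subseteq> nabla_ideal \<kappa> L (ker E)" if D: "D \<in> ?X" for D
  proof -
    obtain I where I: "kideal \<kappa> L I" "D = nabla_ideal \<kappa> L I" "nabla_ideal \<kappa> L I \<subseteq> E"
      using D by blast
    then have "I \<subseteq> ker E"
      using nabla_ideal_subset_iff[OF I(1) E] by simp
    then have "D \<subseteq> nabla_ideal \<kappa> L (ker E)"
      using nabla_ideal_subset_iff[OF I(1) kcongruence_nabla_ideal[OF kideal_ker[OF E]]]
      by (simp add: I(2) ker_nabla_ideal[OF kideal_ker[OF E]])
    then show ?thesis
      using kcongruence_nabla_ideal[OF I(1)] by (simp add: I(2))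
  qed
  ultimately show "greatest (Con \<kappa> L) (nabla_ideal \<kappa> L (ker E)) ?X"
    unfolding greatest_def Con_def by simp blast
qed

text \<open>
  One inclusion in the definition of density says that the kernel of \<open>E\<close> includes \<open>I\<close>, the other,
  through the closure, that it is included in \<open>I\<close>.
\<close>

lemma dense_in_nabla_ideal_iff:
  assumes E: "kcongruence \<kappa> L E" and I: "kideal \<kappa> L I"
  shows "dense_in \<kappa> L E (nabla_ideal \<kappa> L I) \<longleftrightarrow> ker E = I"
  unfolding dense_in_def con_closure_eq[OF E] nabla_ideal_subset_iff[OF I E]
    nabla_ideal_subset_iff[OF kideal_ker[OF E] kcongruence_nabla_ideal[OF I]]
    ker_nabla_ideal[OF I]
  by blast

lemma clear_con_of_eq:
  assumes I: "kideal \<kappa> L I"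
  shows "clear_con_of \<kappa> L I = syntactic_con I"
  unfolding clear_con_of_def
proof (rule The_greatest_Con)
  have "E \<subseteq> syntactic_con I" if "kcongruence \<kappa> L E" "ker E = I" for E
    using subset_syntactic_con_ker[OF that(1)] that(2) by simp
  moreover have "{E. kcongruence \<kappa> L E \<and> dense_in \<kappa> L E (nabla_ideal \<kappa> L I)} =
      {E. kcongruence \<kappa> L E \<and> ker E = I}"
    using dense_in_nabla_ideal_iff[OF _ I] by blast
  ultimately show "greatest (Con \<kappa> L) (syntactic_con I)
      {E. kcongruence \<kappa> L E \<and> dense_in \<kappa> L E (nabla_ideal \<kappa> L I)}"
    using kcongruence_syntactic_con[OF I] ker_syntactic_con[OF I]
    by (auto simp: greatest_def Con_def)
qed

text \<open>
  The ideal witnessing that \<open>C\<close> is clear can only be the kernel of \<open>C\<close>, since a syntactic congruence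
  determines its ideal.
\<close>

lemma clear_congruence_iff:
  assumes C: "kcongruence \<kappa> L C"
  shows "clear_congruence \<kappa> L C \<longleftrightarrow> syntactic_con (ker C) \<subseteq> C"
proof
  assume "clear_congruence \<kappa> L C"
  then show "syntactic_con (ker C) \<subseteq> C"
    by (auto simp: clear_congruence_def clear_con_of_eq ker_syntactic_con)
next
  assume "syntactic_con (ker C) \<subseteq> C"
  then have "C = clear_con_of \<kappa> L (ker C)"
    using subset_syntactic_con_ker[OF C] by (simp add: clear_con_of_eq[OF kideal_ker[OF C]])
  then show "clear_congruence \<kappa> L C"
    unfolding clear_congruence_def using kideal_ker[OF C] by blast
qed

text \<open>
  Since the equality is itself generated by the ideal \<open>{\<bottom>}\<close>, the largest dense congruence is the
  case \<open>I = {\<bottom>}\<close> of the largest congruence dense in the one generated by \<open>I\<close>.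
\<close>

lemma nabla_ideal_bottom: "nabla_ideal \<kappa> L {\<bottom>} = Id_on (carrier L)"
proof
  show "nabla_ideal \<kappa> L {\<bottom>} \<subseteq> Id_on (carrier L)"
    using nabla_ideal_subset_iff[OF kideal_bottom kcongruence_Id_on] by (simp add: ker_def Id_on_iff)
  show "Id_on (carrier L) \<subseteq> nabla_ideal \<kappa> L {\<bottom>}"
    using kcongruence_refl[OF kcongruence_nabla_ideal[OF kideal_bottom]] by auto
qed

lemma clear_kframe_iff:
  "clear_kframe \<kappa> L \<longleftrightarrow> syntactic_con {\<bottom>} \<subseteq> Id_on (carrier L)"
proof -
  have "largest_dense_con \<kappa> L = clear_con_of \<kappa> L {\<bottom>}"
    by (simp add: largest_dense_con_def clear_con_of_def nabla_ideal_bottom)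
  also have "\<dots> = syntactic_con {\<bottom>}"
    by (rule clear_con_of_eq[OF kideal_bottom])
  finally have "clear_kframe \<kappa> L \<longleftrightarrow> syntactic_con {\<bottom>} = Id_on (carrier L)"
    using kframe_axioms by (simp add: clear_kframe_def)
  moreover have "Id_on (carrier L) \<subseteq> syntactic_con {\<bottom>}"
    by (auto simp: syntactic_con_def)
  ultimately show ?thesis
    by blast
qed

end

section \<open>The quotient frame\<close>

locale kframe_quotient = infinitary_kframe \<kappa> L
  for \<kappa> :: "'k rel option" and L (structure) +
  fixes C :: "'a rel"
  assumes con: "kcongruence \<kappa> L C"
begin

abbreviation Q :: "'a set gorder" where
  "Q \<equiv> quotient_frame L C"

definition cls :: "'a \<Rightarrow> 'a set" where
  "cls a = C `` {a}"

lemma equiv_C: "equiv (carrier L) C"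
  using con by (simp add: kcongruence_def)

lemma carrier_Q: "carrier Q = cls ` carrier L"
  by (auto simp: quotient_frame_def quotient_def cls_def)

lemma cls_closed: "a \<in> carrier L \<Longrightarrow> cls a \<in> carrier Q"
  by (simp add: carrier_Q)

lemma cls_eq_iff:
  assumes "a \<in> carrier L" "b \<in> carrier L"
  shows "cls a = cls b \<longleftrightarrow> (a, b) \<in> C"
  using eq_equiv_class_iff[OF equiv_C assms] by (simp add: cls_def)

text \<open>The order on classes does not depend on the representatives.\<close>

lemma le_Q_iff:
  assumes "a \<in> carrier L" "b \<in> carrier L"
  shows "cls a \<sqsubseteq>\<^bsub>Q\<^esub> cls b \<longleftrightarrow> (a \<sqinter> b, a) \<in> C"
proof
  assume "cls a \<sqsubseteq>\<^bsub>Q\<^esub> cls b"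
  then obtain a' b' where "(a, a') \<in> C" "(b, b') \<in> C" "(a, a' \<sqinter> b') \<in> C"
    by (auto simp: quotient_frame_def cls_def)
  then show "(a \<sqinter> b, a) \<in> C"
    by (meson con kcongruence_meet kcongruence_sym kcongruence_trans)
next
  assume "(a \<sqinter> b, a) \<in> C"
  then have "a \<sqinter> b \<in> cls a"
    using kcongruence_sym[OF con] by (simp add: cls_def)
  moreover have "a \<in> cls a" "b \<in> cls b"
    using assms kcongruence_refl[OF con] by (simp_all add: cls_def)
  ultimately show "cls a \<sqsubseteq>\<^bsub>Q\<^esub> cls b"
    by (auto simp: quotient_frame_def)
qed

lemma cls_mono:
  assumes "a \<in> carrier L" "b \<in> carrier L" "a \<sqsubseteq> b"
  shows "cls a \<sqsubseteq>\<^bsub>Q\<^esub> cls b"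
  using assms le_Q_iff kcongruence_refl[OF con] le_iff_join by fastforce

lemma partial_order_Q: "partial_order Q"
proof
  fix X assume "X \<in> carrier Q"
  then show "X \<sqsubseteq>\<^bsub>Q\<^esub> X"
    by (auto simp: carrier_Q intro: cls_mono)
next
  fix X Y assume "X \<sqsubseteq>\<^bsub>Q\<^esub> Y" "Y \<sqsubseteq>\<^bsub>Q\<^esub> X" "X \<in> carrier Q" "Y \<in> carrier Q"
  then obtain a b where ab: "a \<in> carrier L" "b \<in> carrier L" "X = cls a" "Y = cls b"
    "(a \<sqinter> b, a) \<in> C" "(b \<sqinter> a, b) \<in> C"
    by (auto simp: carrier_Q le_Q_iff)
  then have "(a, b) \<in> C"
    by (metis con kcongruence_sym kcongruence_trans meet_comm)
  then show "X .=\<^bsub>Q\<^esub> Y"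
    using ab by (simp add: quotient_frame_def cls_eq_iff)
next
  fix X Y Z assume "X \<sqsubseteq>\<^bsub>Q\<^esub> Y" "Y \<sqsubseteq>\<^bsub>Q\<^esub> Z"
    "X \<in> carrier Q" "Y \<in> carrier Q" "Z \<in> carrier Q"
  then obtain a b c where abc: "a \<in> carrier L" "b \<in> carrier L" "c \<in> carrier L"
    "X = cls a" "Y = cls b" "Z = cls c" "(a \<sqinter> b, a) \<in> C" "(b \<sqinter> c, b) \<in> C"
    by (auto simp: carrier_Q le_Q_iff)
  have "(a \<sqinter> c, (a \<sqinter> b) \<sqinter> c) \<in> C"
    using abc by (meson con kcongruence_meet kcongruence_sym kcongruence_refl)
  moreover have "(a \<sqinter> (b \<sqinter> c), a \<sqinter> b) \<in> C"
    using abc by (meson con kcongruence_meet kcongruence_refl)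
  ultimately have "(a \<sqinter> c, a) \<in> C"
    using abc meet_assoc by (metis con kcongruence_trans)
  then show "X \<sqsubseteq>\<^bsub>Q\<^esub> Z"
    using abc by (simp add: le_Q_iff)
qed (auto simp: quotient_frame_def)

sublocale Q: partial_order Q
  by (rule partial_order_Q)

lemma glb_Q:
  assumes "a \<in> carrier L" "b \<in> carrier L"
  shows "greatest Q (cls (a \<sqinter> b)) (Lower Q {cls a, cls b})"
proof (rule greatest_LowerI)
  show "cls (a \<sqinter> b) \<sqsubseteq>\<^bsub>Q\<^esub> X" if "X \<in> {cls a, cls b}" for X
    using that assms cls_mono meet_left meet_right by auto
next
  fix X assume X: "X \<in> Lower Q {cls a, cls b}"
  then obtain u where u: "u \<in> carrier L" "X = cls u"
    by (auto simp: Lower_def carrier_Q)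
  with X assms have "(u \<sqinter> a, u) \<in> C" "(u \<sqinter> b, u) \<in> C"
    by (auto simp: Lower_def cls_closed le_Q_iff)
  then have "((u \<sqinter> a) \<sqinter> b, u) \<in> C"
    using assms(2) by (meson con kcongruence_meet kcongruence_refl kcongruence_trans)
  then show "X \<sqsubseteq>\<^bsub>Q\<^esub> cls (a \<sqinter> b)"
    using u assms by (simp add: le_Q_iff meet_assoc)
qed (use assms in \<open>auto simp: cls_closed\<close>)

text \<open>
  If the class of \<open>u\<close> is an upper bound, then \<open>u \<sqinter> t\<close> is congruent to \<open>t\<close> for every \<open>t \<in> T\<close>; closure of
  \<open>C\<close> under \<open>\<kappa>\<close>-joins and distributivity then give that \<open>u \<sqinter> \<Squnion>T\<close> is congruent to \<open>\<Squnion>T\<close>.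
\<close>

lemma lub_Q:
  assumes T: "T \<subseteq> carrier L" "kset \<kappa> T"
  shows "least Q (cls (\<Squnion>T)) (Upper Q (cls ` T))"
proof (rule least_UpperI)
  show "X \<sqsubseteq>\<^bsub>Q\<^esub> cls (\<Squnion>T)" if "X \<in> cls ` T" for X
    using that T kjoin_upper[OF T] kjoin_closed[OF T] by (auto intro!: cls_mono)
next
  fix X assume X: "X \<in> Upper Q (cls ` T)"
  then obtain u where u: "u \<in> carrier L" "X = cls u"
    by (auto simp: Upper_def carrier_Q)
  with X T have "(u \<sqinter> t, t) \<in> C" if "t \<in> T" for t
    using that meet_comm[of L u] by (auto simp: Upper_def cls_closed le_Q_iff subset_eq)
  then have "(\<Squnion>((\<lambda>t. u \<sqinter> t) ` T), \<Squnion>((\<lambda>t. t) ` T)) \<in> C"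
    using con T(2) by (intro kcongruence_kjoin)
  then have "(\<Squnion>T \<sqinter> u, \<Squnion>T) \<in> C"
    using meet_kjoin_distrib[OF u(1) T] meet_comm[of L u] by simp
  then show "cls (\<Squnion>T) \<sqsubseteq>\<^bsub>Q\<^esub> X"
    using u kjoin_closed[OF T] by (simp add: le_Q_iff)
qed (use T kjoin_closed[OF T] in \<open>auto simp: cls_closed\<close>)

text \<open>
  One representative per class makes \<open>T\<close> an injective copy of \<open>S\<close>, hence again a \<open>\<kappa>\<close>-set; the union
  of the classes may be too large.
\<close>

lemma small_subset_Q:
  assumes "S \<subseteq> carrier Q" "kset \<kappa> S"
  obtains T where "T \<subseteq> carrier L" "kset \<kappa> T" "S = cls ` T"
proof -
  obtain T where "T \<subseteq> carrier L" "S = cls ` T" "inj_on cls T"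
    using assms(1) unfolding carrier_Q by (meson subset_image_inj)
  moreover from this have "T = the_inv_into T cls ` S"
    by simp
  then have "kset \<kappa> T"
    using kset_image[OF assms(2)] by metis
  ultimately show thesis
    using that by blast
qed

lemma bottom_Q: "\<bottom>\<^bsub>Q\<^esub> = cls \<bottom>"
  and top_exists_Q: "\<exists>x. greatest Q x (carrier Q)"
  and bottom_exists_Q: "\<exists>x. least Q x (carrier Q)"
proof -
  have bot: "least Q (cls \<bottom>) (carrier Q)"
    by (auto simp: least_def carrier_Q intro: cls_mono)
  then show "\<exists>x. least Q x (carrier Q)" by blast
  show "\<bottom>\<^bsub>Q\<^esub> = cls \<bottom>"
    unfolding bottom_def[of Q] using bot Q.least_unique[OF _ bot] by (rule some_equality)
  have "greatest Q (cls \<top>) (carrier Q)"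
    by (auto simp: greatest_def carrier_Q intro: cls_mono)
  then show "\<exists>x. greatest Q x (carrier Q)" by blast
qed

lemma meet_Q:
  assumes "a \<in> carrier L" "b \<in> carrier L"
  shows "cls a \<sqinter>\<^bsub>Q\<^esub> cls b = cls (a \<sqinter> b)"
  unfolding meet_def[of Q] inf_def[of Q]
  using glb_Q[OF assms] Q.greatest_unique[OF _ glb_Q[OF assms]] by (rule some_equality)

lemma kjoin_Q:
  assumes "T \<subseteq> carrier L" "kset \<kappa> T"
  shows "\<Squnion>\<^bsub>Q\<^esub>(cls ` T) = cls (\<Squnion>T)"
  unfolding sup_def[of Q]
  using lub_Q[OF assms] Q.least_unique[OF _ lub_Q[OF assms]] by (rule some_equality)

lemma infinitary_kframe_Q: "infinitary_kframe \<kappa> Q"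
proof
  show exists: "\<exists>s. least Q s (Upper Q S)" if "S \<subseteq> carrier Q" "kset \<kappa> S" for S
    using small_subset_Q[OF that] lub_Q by metis
  show "\<exists>s. least Q s (Upper Q {X, Y})" if "X \<in> carrier Q" "Y \<in> carrier Q" for X Y
    using that by (intro exists kset_finite[OF regular]) auto
  show "\<exists>s. greatest Q s (Lower Q {X, Y})" if "X \<in> carrier Q" "Y \<in> carrier Q" for X Y
    using that glb_Q by (auto simp: carrier_Q)
  show "X \<sqinter>\<^bsub>Q\<^esub> (\<Squnion>\<^bsub>Q\<^esub>S) = \<Squnion>\<^bsub>Q\<^esub>((\<lambda>Y. X \<sqinter>\<^bsub>Q\<^esub> Y) ` S)"
    if X: "X \<in> carrier Q" and S: "S \<subseteq> carrier Q" "kset \<kappa> S" for X S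
  proof -
    obtain a where a: "a \<in> carrier L" "X = cls a"
      using X by (auto simp: carrier_Q)
    obtain T where T: "T \<subseteq> carrier L" "kset \<kappa> T" "S = cls ` T"
      using small_subset_Q[OF S] .
    have "X \<sqinter>\<^bsub>Q\<^esub> (\<Squnion>\<^bsub>Q\<^esub>S) = cls (a \<sqinter> \<Squnion>T)"
      using a T by (simp add: kjoin_Q meet_Q kjoin_closed)
    also have "\<dots> = cls (\<Squnion>((\<lambda>t. a \<sqinter> t) ` T))"
      using a T by (simp add: meet_kjoin_distrib)
    also have "\<dots> = \<Squnion>\<^bsub>Q\<^esub>(cls ` (\<lambda>t. a \<sqinter> t) ` T)"
      using a T by (intro kjoin_Q[symmetric] kset_image) auto
    also have "cls ` (\<lambda>t. a \<sqinter> t) ` T = (\<lambda>Y. X \<sqinter>\<^bsub>Q\<^esub> Y) ` S"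
      using a T meet_Q by (auto simp: image_image subset_eq intro!: image_cong)
    finally show ?thesis .
  qed
qed (use top_exists_Q bottom_exists_Q regular in auto)

sublocale Q: infinitary_kframe \<kappa> Q
  by (rule infinitary_kframe_Q)

text \<open>
  A test of a class against \<open>\<bottom>\<close> in the quotient is a test of its representative against the kernel
  of \<open>C\<close>.
\<close>

lemma syntactic_con_Q_iff:
  assumes "a \<in> carrier L" "b \<in> carrier L"
  shows "(cls a, cls b) \<in> Q.syntactic_con {\<bottom>\<^bsub>Q\<^esub>} \<longleftrightarrow> (a, b) \<in> syntactic_con (ker C)"
proof -
  have "cls y = cls \<bottom> \<longleftrightarrow> y \<in> ker C" if "y \<in> carrier L" for y
    using that cls_eq_iff[of \<bottom> y] by (auto simp: ker_def)
  then show ?thesis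
    using assms
    by (simp add: Q.syntactic_con_def syntactic_con_def cls_closed bottom_Q meet_Q carrier_Q)
qed

lemma clear_kframe_Q_iff: "clear_kframe \<kappa> Q \<longleftrightarrow> clear_congruence \<kappa> L C"
proof -
  have "Q.syntactic_con {\<bottom>\<^bsub>Q\<^esub>} \<subseteq> Id_on (carrier Q) \<longleftrightarrow>
    (\<forall>a\<in>carrier L. \<forall>b\<in>carrier L.
       (cls a, cls b) \<in> Q.syntactic_con {\<bottom>\<^bsub>Q\<^esub>} \<longrightarrow> cls a = cls b)"
  proof -
    have "Q.syntactic_con {\<bottom>\<^bsub>Q\<^esub>} \<subseteq> Id_on (carrier Q) \<longleftrightarrow>
      (\<forall>X\<in>carrier Q. \<forall>Y\<in>carrier Q. (X, Y) \<in> Q.syntactic_con {\<bottom>\<^bsub>Q\<^esub>} \<longrightarrow> X = Y)"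
      by (auto simp: Q.syntactic_con_def)
    then show ?thesis
      by (simp only: carrier_Q ball_simps)
  qed
  also have "\<dots> \<longleftrightarrow> syntactic_con (ker C) \<subseteq> C"
  proof -
    have "syntactic_con (ker C) \<subseteq> carrier L \<times> carrier L"
      by (auto simp: syntactic_con_def)
    then show ?thesis
      by (auto simp: syntactic_con_Q_iff cls_eq_iff)
  qed
  finally show ?thesis
    by (simp add: Q.clear_kframe_iff clear_congruence_iff[OF con])
qed

end

theorem mainTheorem3:
  fixes \<kappa> :: "'k rel option" and L :: "('a, 'm) gorder_scheme" and C :: "'a rel"
  assumes "regular_or_infty \<kappa>"
    and "kframe \<kappa> L"
    and "kcongruence \<kappa> L C"
  shows "clear_kframe \<kappa> (quotient_frame L C) \<longleftrightarrow> clear_congruence \<kappa> L C"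
proof -
  interpret kframe_quotient \<kappa> L C
    using assms
    by (simp add: kframe_quotient_def kframe_quotient_axioms_def
        infinitary_kframe_def infinitary_kframe_axioms_def)
  show ?thesis
    by (rule clear_kframe_Q_iff)
qed

end
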